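(* Let $\Phi:\mathsf{DSC}\to\mathsf{AntiMat}$ be the functor given on objects by $\Phi(E,\mathrm{dep})=(E,\mathsf{rdp}(E))$ and acting as the identity on underlying functions of morphisms, and let $\Psi:\mathsf{AntiMat}\to\mathsf{DSC}$ be the functor given on objects by $\Psi(E,\mathcal F)=(E,\mathrm{dep}_{\mathcal F})$ and acting as the identity on underlying functions of morphisms. Then $\Phi$ and $\Psi$ are inverse to each other, defining an isomorphism of categories $\mathsf{DSC}\cong\mathsf{AntiMat}$.
   Context: $P(A)$ denotes the power set of $A$. A preDSC is a pair $(E,\mathrm{dep})$ with $E$ a finite set and $\mathrm{dep}:E\to P(P(E))$ a function; the elements of $\mathrm{dep}(e)$ are called depsets of $e$. For $X,Y\subseteq E$ write $X\,\mathrm{rch}\,Y$ if $X\subseteq Y$ and for every $y\in Y$ there is $D\in\mathrm{dep}(y)$ with $D\subseteq X$. A subset $X\subseteq E$ is reachable if there is a finite sequence of subsets $X_0,\dots,X_n$ with $\varnothing\,\mathrm{rch}\,X_0\,\mathrm{rch}\cdots\mathrm{rch}\,X_n\,\mathrm{rch}\,X$. $\mathsf{rdp}(E)$ is the set of reachable subsets of $E$ (ordered by inclusion). A subset $X\subseteq E$ is complete if every $e\in X$ has a depset $D\in\mathrm{dep}(e)$ with $D\subseteq X$. A DSC (dependency structure with choice) is a preDSC which is irredundant (if $D_0,D_1\in\mathrm{dep}(e)$ and $D_0\subseteq D_1$ then $D_0=D_1$), acyclic ($e\notin D$ for all $D\in\mathrm{dep}(e)$), nonsingular ($\mathrm{dep}(e)\ne\varnothing$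 for all $e$), and has complete depsets (every $D\in\mathrm{dep}(e)$ is a complete subset, for all $e$). A morphism of (pre)DSCs $f:(E,\mathrm{dep})\to(E',\mathrm{dep}')$ is a function $f:E\to E'$ such that $f^{-1}(X)$ is reachable for every reachable $X\subseteq E'$. $\mathsf{DSC}$ is the category of DSCs and these morphisms. An antimatroid is a pair $(E,\mathcal F)$ with $E$ a finite set and $\mathcal F\subseteq P(E)$ a nonempty family (of "feasible" sets) such that: (A1) $A,B\in\mathcal F$ implies $A\cup B\in\mathcal F$; (A2) if $\varnothing\neq S\in\mathcal F$ then there is $x\in S$ with $S\setminus\{x\}\in\mathcal F$; (A3) $E=\bigcup_{A\in\mathcal F}A$. A morphism of antimatroids $f:(E,\mathcal F)\to(E',\mathcal F')$ is a function $f:E\to E'$ with $f^{-1}(A)\in\mathcal F$ for all $A\in\mathcal F'$. $\mathsf{AntiMat}$ is the category of antimatroids. For $e\in E$, a feasible set $X$ is $e$-minimal feasible if $e\in X$ and every feasible $Y\subseteq X$ with $e\in Y$ equals $X$. Define $\mathrm{dep}_{\mathcal F}(e)=\{M\setminus\{e\}: M \text{ is an } e\text{-minimal feasible set}\}$. *)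

theory Defs
  imports Main "HOL-Library.FuncSet"
begin

section \<open>Categories and functors\<close>

record ('o, 'm) category_data =
  Obj :: "'o set"
  Arr :: "'m set"
  Dom :: "'m \<Rightarrow> 'o"
  Cod :: "'m \<Rightarrow> 'o"
  Ident :: "'o \<Rightarrow> 'm"
  Comp :: "'m \<Rightarrow> 'm \<Rightarrow> 'm"  \<comment> \<open>\<open>Comp C g f\<close> is \<open>g\<close> after \<open>f\<close>; only meaningful if \<open>Cod C f = Dom C g\<close>\<close>

locale category =
  fixes C :: "('o, 'm) category_data"
  assumes dom_in: "f \<in> Arr C \<Longrightarrow> Dom C f \<in> Obj C"
    and cod_in: "f \<in> Arr C \<Longrightarrow> Cod C f \<in> Obj C"
    and ident_in: "X \<in> Obj C \<Longrightarrow> Ident C X \<in> Arr C"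
    and dom_ident: "X \<in> Obj C \<Longrightarrow> Dom C (Ident C X) = X"
    and cod_ident: "X \<in> Obj C \<Longrightarrow> Cod C (Ident C X) = X"
    and comp_in: "\<lbrakk>f \<in> Arr C; g \<in> Arr C; Cod C f = Dom C g\<rbrakk> \<Longrightarrow> Comp C g f \<in> Arr C"
    and dom_comp: "\<lbrakk>f \<in> Arr C; g \<in> Arr C; Cod C f = Dom C g\<rbrakk> \<Longrightarrow> Dom C (Comp C g f) = Dom C f"
    and cod_comp: "\<lbrakk>f \<in> Arr C; g \<in> Arr C; Cod C f = Dom C g\<rbrakk> \<Longrightarrow> Cod C (Comp C g f) = Cod C g"
    and comp_ident_right: "f \<in> Arr C \<Longrightarrow> Comp C f (Ident C (Dom C f)) = f"
    and comp_ident_left: "f \<in> Arr C \<Longrightarrow> Comp C (Ident C (Cod C f)) f = f"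
    and comp_assoc: "\<lbrakk>f \<in> Arr C; g \<in> Arr C; h \<in> Arr C; Cod C f = Dom C g; Cod C g = Dom C h\<rbrakk>
      \<Longrightarrow> Comp C h (Comp C g f) = Comp C (Comp C h g) f"

record ('o, 'm, 'p, 'n) functor_data =
  on_obj :: "'o \<Rightarrow> 'p"
  on_arr :: "'m \<Rightarrow> 'n"

locale category_functor = source: category C + target: category D
  for C :: "('o, 'm) category_data" and D :: "('p, 'n) category_data" +
  fixes F :: "('o, 'm, 'p, 'n) functor_data"
  assumes on_obj_in: "X \<in> Obj C \<Longrightarrow> on_obj F X \<in> Obj D"
    and on_arr_in: "f \<in> Arr C \<Longrightarrow> on_arr F f \<in> Arr D"
    and dom_on_arr: "f \<in> Arr C \<Longrightarrow> Dom D (on_arr F f) = on_obj F (Dom C f)"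
    and cod_on_arr: "f \<in> Arr C \<Longrightarrow> Cod D (on_arr F f) = on_obj F (Cod C f)"
    and on_arr_ident: "X \<in> Obj C \<Longrightarrow> on_arr F (Ident C X) = Ident D (on_obj F X)"
    and on_arr_comp: "\<lbrakk>f \<in> Arr C; g \<in> Arr C; Cod C f = Dom C g\<rbrakk>
      \<Longrightarrow> on_arr F (Comp C g f) = Comp D (on_arr F g) (on_arr F f)"

definition id_functor :: "('o, 'm, 'o, 'm) functor_data" where
  "id_functor = \<lparr>on_obj = id, on_arr = id\<rparr>"

definition comp_functor ::
  "('p, 'n, 'q, 'k) functor_data \<Rightarrow> ('o, 'm, 'p, 'n) functor_data \<Rightarrow> ('o, 'm, 'q, 'k) functor_data"
  where "comp_functor G F =
    \<lparr>on_obj = on_obj G \<circ> on_obj F, on_arr = on_arr G \<circ> on_arr F\<rparr>"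

text \<open>Functors are HOL functions on the whole object and arrow types, so their equality
  is taken on the objects and arrows of the source category.\<close>

definition eq_functor_on ::
  "('o, 'm) category_data \<Rightarrow> ('o, 'm, 'p, 'n) functor_data \<Rightarrow> ('o, 'm, 'p, 'n) functor_data \<Rightarrow> bool"
  where "eq_functor_on C F G \<longleftrightarrow>
    (\<forall>X\<in>Obj C. on_obj F X = on_obj G X) \<and> (\<forall>f\<in>Arr C. on_arr F f = on_arr G f)"

definition inverse_functors ::
  "('o, 'm) category_data \<Rightarrow> ('p, 'n) category_data \<Rightarrow>
    ('o, 'm, 'p, 'n) functor_data \<Rightarrow> ('p, 'n, 'o, 'm) functor_data \<Rightarrow> bool"
  where "inverse_functors C D F G \<longleftrightarrow>
    category_functor C D F \<and> category_functor D C G \<and>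
    eq_functor_on C (comp_functor G F) id_functor \<and>
    eq_functor_on D (comp_functor F G) id_functor"

definition isomorphic_categories ::
  "('o, 'm) category_data \<Rightarrow> ('p, 'n) category_data \<Rightarrow> bool"
  where "isomorphic_categories C D \<longleftrightarrow> (\<exists>F G. inverse_functors C D F G)"

section \<open>Categories of finite sets with structure\<close>

text \<open>An object is a carrier set paired with a structure on it. An arrow records its domain and
  codomain together with the underlying function, which is extensional on the carrier of the
  domain, so that two arrows are equal iff they agree as functions between the carriers.\<close>

type_synonym ('a, 's) arrow = "('a set \<times> 's) \<times> ('a set \<times> 's) \<times> ('a \<Rightarrow> 'a)"

definition structured_sets ::
  "('a set \<times> 's) set \<Rightarrow> ('a set \<times> 's \<Rightarrow> 'a set \<times> 's \<Rightarrow> ('a \<Rightarrow> 'a) \<Rightarrow> bool) \<Rightarrow>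
    ('a set \<times> 's, ('a, 's) arrow) category_data"
  where "structured_sets Obs mor =
    \<lparr>Obj = Obs,
     Arr = {(A, B, f). A \<in> Obs \<and> B \<in> Obs \<and> f \<in> fst A \<rightarrow>\<^sub>E fst B \<and> mor A B f},
     Dom = (\<lambda>(A, B, f). A),
     Cod = (\<lambda>(A, B, f). B),
     Ident = (\<lambda>A. (A, A, \<lambda>x\<in>fst A. x)),
     Comp = (\<lambda>(B', C, g) (A, B, f). (A, C, compose (fst A) g f))\<rparr>"

definition identity_on_maps ::
  "('a set \<times> 's \<Rightarrow> 'a set \<times> 't) \<Rightarrow>
    ('a set \<times> 's, ('a, 's) arrow, 'a set \<times> 't, ('a, 't) arrow) functor_data"
  where "identity_on_maps F = \<lparr>on_obj = F, on_arr = (\<lambda>(A, B, f). (F A, F B, f))\<rparr>"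

section \<open>Dependency structures with choice\<close>

text \<open>The function \<open>dep\<close> has domain \<open>E\<close>; it is \<open>undefined\<close> outside \<open>E\<close>, so equality of pairs
  \<open>(E, dep)\<close> is equality of preDSCs.\<close>

definition preDSC :: "'a set \<Rightarrow> ('a \<Rightarrow> 'a set set) \<Rightarrow> bool" where
  "preDSC E dep \<longleftrightarrow> finite E \<and> dep \<in> E \<rightarrow>\<^sub>E Pow (Pow E)"

definition rch :: "'a set \<Rightarrow> ('a \<Rightarrow> 'a set set) \<Rightarrow> 'a set \<Rightarrow> 'a set \<Rightarrow> bool" where
  "rch E dep X Y \<longleftrightarrow> X \<subseteq> E \<and> Y \<subseteq> E \<and> X \<subseteq> Y \<and> (\<forall>y\<in>Y. \<exists>D\<in>dep y. D \<subseteq> X)"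

definition reachable :: "'a set \<Rightarrow> ('a \<Rightarrow> 'a set set) \<Rightarrow> 'a set \<Rightarrow> bool" where
  "reachable E dep X \<longleftrightarrow>
    (\<exists>(n::nat) (Xs :: nat \<Rightarrow> 'a set).
      rch E dep {} (Xs 0) \<and> (\<forall>i<n. rch E dep (Xs i) (Xs (Suc i))) \<and> rch E dep (Xs n) X)"

definition rdp :: "'a set \<Rightarrow> ('a \<Rightarrow> 'a set set) \<Rightarrow> 'a set set" where
  "rdp E dep = {X. X \<subseteq> E \<and> reachable E dep X}"

definition complete_subset :: "'a set \<Rightarrow> ('a \<Rightarrow> 'a set set) \<Rightarrow> 'a set \<Rightarrow> bool" where
  "complete_subset E dep X \<longleftrightarrow> X \<subseteq> E \<and> (\<forall>e\<in>X. \<exists>D\<in>dep e. D \<subseteq> X)"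

definition irredundant :: "'a set \<Rightarrow> ('a \<Rightarrow> 'a set set) \<Rightarrow> bool" where
  "irredundant E dep \<longleftrightarrow> (\<forall>e\<in>E. \<forall>D0\<in>dep e. \<forall>D1\<in>dep e. D0 \<subseteq> D1 \<longrightarrow> D0 = D1)"

definition acyclic_dep :: "'a set \<Rightarrow> ('a \<Rightarrow> 'a set set) \<Rightarrow> bool" where
  "acyclic_dep E dep \<longleftrightarrow> (\<forall>e\<in>E. \<forall>D\<in>dep e. e \<notin> D)"

definition nonsingular :: "'a set \<Rightarrow> ('a \<Rightarrow> 'a set set) \<Rightarrow> bool" where
  "nonsingular E dep \<longleftrightarrow> (\<forall>e\<in>E. dep e \<noteq> {})"

definition complete_depsets :: "'a set \<Rightarrow> ('a \<Rightarrow> 'a set set) \<Rightarrow> bool" where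
  "complete_depsets E dep \<longleftrightarrow> (\<forall>e\<in>E. \<forall>D\<in>dep e. complete_subset E dep D)"

definition is_DSC :: "'a set \<Rightarrow> ('a \<Rightarrow> 'a set set) \<Rightarrow> bool" where
  "is_DSC E dep \<longleftrightarrow> preDSC E dep \<and> irredundant E dep \<and> acyclic_dep E dep \<and>
    nonsingular E dep \<and> complete_depsets E dep"

definition DSC_morphism ::
  "'a set \<times> ('a \<Rightarrow> 'a set set) \<Rightarrow> 'a set \<times> ('a \<Rightarrow> 'a set set) \<Rightarrow> ('a \<Rightarrow> 'a) \<Rightarrow> bool" where
  "DSC_morphism = (\<lambda>(E, dep) (E', dep') f. f \<in> E \<rightarrow> E' \<and>
    (\<forall>X\<subseteq>E'. reachable E' dep' X \<longrightarrow> reachable E dep (f -` X \<inter> E)))"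

type_synonym 'a DSC_category =
  "('a set \<times> ('a \<Rightarrow> 'a set set), ('a, 'a \<Rightarrow> 'a set set) arrow) category_data"

definition DSC :: "'a DSC_category" where
  "DSC = structured_sets {(E, dep). is_DSC E dep} DSC_morphism"

section \<open>Antimatroids\<close>

definition antimatroid :: "'a set \<Rightarrow> 'a set set \<Rightarrow> bool" where
  "antimatroid E \<F> \<longleftrightarrow> finite E \<and> \<F> \<subseteq> Pow E \<and> \<F> \<noteq> {} \<and>
    (\<forall>A\<in>\<F>. \<forall>B\<in>\<F>. A \<union> B \<in> \<F>) \<and>
    (\<forall>S\<in>\<F>. S \<noteq> {} \<longrightarrow> (\<exists>x\<in>S. S - {x} \<in> \<F>)) \<and>
    E = \<Union>\<F>"

definition antimatroid_morphism ::
  "'a set \<times> 'a set set \<Rightarrow> 'a set \<times> 'a set set \<Rightarrow> ('a \<Rightarrow> 'a) \<Rightarrow> bool" where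
  "antimatroid_morphism = (\<lambda>(E, \<F>) (E', \<F>') f. f \<in> E \<rightarrow> E' \<and> (\<forall>A\<in>\<F>'. f -` A \<inter> E \<in> \<F>))"

type_synonym 'a AntiMat_category =
  "('a set \<times> 'a set set, ('a, 'a set set) arrow) category_data"

definition AntiMat :: "'a AntiMat_category" where
  "AntiMat = structured_sets {(E, \<F>). antimatroid E \<F>} antimatroid_morphism"

definition minimal_feasible :: "'a set set \<Rightarrow> 'a \<Rightarrow> 'a set \<Rightarrow> bool" where
  "minimal_feasible \<F> e X \<longleftrightarrow> X \<in> \<F> \<and> e \<in> X \<and> (\<forall>Y\<in>\<F>. Y \<subseteq> X \<and> e \<in> Y \<longrightarrow> Y = X)"

definition dep_of :: "'a set \<Rightarrow> 'a set set \<Rightarrow> 'a \<Rightarrow> 'a set set" where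
  "dep_of E \<F> = (\<lambda>e\<in>E. {M - {e} | M. minimal_feasible \<F> e M})"

section \<open>The two functors\<close>

definition Phi ::
  "('a set \<times> ('a \<Rightarrow> 'a set set), ('a, 'a \<Rightarrow> 'a set set) arrow,
    'a set \<times> 'a set set, ('a, 'a set set) arrow) functor_data" where
  "Phi = identity_on_maps (\<lambda>(E, dep). (E, rdp E dep))"

definition Psi ::
  "('a set \<times> 'a set set, ('a, 'a set set) arrow,
    'a set \<times> ('a \<Rightarrow> 'a set set), ('a, 'a \<Rightarrow> 'a set set) arrow) functor_data" where
  "Psi = identity_on_maps (\<lambda>(E, \<F>). (E, dep_of E \<F>))"

end

theory Submission
  imports Defs
begin

text \<open>The sequences in the definition of reachability can be eliminated: in a DSC the reachable
  subsets are exactly the complete ones (\<open>rdp_eq_complete_subsets\<close>). Reachable sets are complete in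
  any preDSC. For the converse, acyclicity and completeness of depsets allow a nonempty complete set
  to lose one element and stay complete (\<open>complete_subset_remove_element\<close>), so that it can be built
  up from the empty set one element at a time. The same lemma is the accessibility axiom of the
  antimatroid of reachable sets; the other axioms are immediate for complete sets.

  In an antimatroid, an \<open>e\<close>-minimal feasible set \<open>M\<close> is of the form \<open>insert e D\<close> with \<open>D\<close> feasible,
  because the element that accessibility allows to remove from \<open>M\<close> can only be \<open>e\<close>. This makes
  the sets \<open>D\<close> the depsets of a DSC. Its complete sets are the unions of minimal feasible sets,
  which are all the feasible sets, so \<open>\<F> = rdp E (dep_of E \<F>)\<close> (\<open>rdp_dep_of\<close>). In the other
  direction, in a DSC the \<open>e\<close>-minimal complete sets are exactly the sets \<open>insert e D\<close> with \<open>D\<close> a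
  depset of \<open>e\<close>: such a set is complete because \<open>D\<close> is, and minimal by irredundance
  (\<open>dep_of_rdp\<close>).

  So the two object maps are mutually inverse. Morphisms on both sides are the functions for which
  preimages preserve the distinguished family of sets, and the object maps match these families, so
  nothing more is needed on arrows.\<close>

section \<open>Concrete categories of structured sets\<close>

lemma category_structured_sets:
  assumes ident: "\<And>A. A \<in> Obs \<Longrightarrow> mor A A (\<lambda>x\<in>fst A. x)"
    and comp: "\<And>A B C f g. \<lbrakk>A \<in> Obs; B \<in> Obs; C \<in> Obs; f \<in> fst A \<rightarrow>\<^sub>E fst B; g \<in> fst B \<rightarrow>\<^sub>E fst C;
      mor A B f; mor B C g\<rbrakk> \<Longrightarrow> mor A C (compose (fst A) g f)"
  shows "category (structured_sets Obs mor)"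
proof -
  \<comment> \<open>The unit laws hold on the nose because arrows carry extensional functions.\<close>
  have id_left: "compose X (\<lambda>x\<in>Y. x) f = f" if "f \<in> X \<rightarrow>\<^sub>E Y" for X Y :: "'a set" and f
    using that by (intro ext) (auto simp: compose_def PiE_def extensional_def)
  have id_right: "compose X f (\<lambda>x\<in>X. x) = f" if "f \<in> X \<rightarrow>\<^sub>E Y" for X Y :: "'a set" and f
    using that by (intro ext) (auto simp: compose_def PiE_def extensional_def)
  have assoc: "compose X h (compose X g f) = compose X (compose Y h g) f"
    if "f \<in> X \<rightarrow>\<^sub>E Y" for X Y :: "'a set" and f g h
    using that by (intro ext) (auto simp: compose_def)
  have comp_PiE: "compose X g f \<in> X \<rightarrow>\<^sub>E Z"
    if "f \<in> X \<rightarrow>\<^sub>E Y" "g \<in> Y \<rightarrow>\<^sub>E Z" for X Y Z :: "'a set" and f g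
    using that by (auto simp: compose_def)
  show ?thesis
    unfolding structured_sets_def
    by unfold_locales
      (auto intro: ident comp id_left id_right assoc dest: comp_PiE)
qed

text \<open>Identities and composites in \<open>structured_sets\<close> depend only on the carriers, so a map of
  objects that fixes carriers and preserves morphisms is automatically functorial.\<close>

lemma category_functor_identity_on_maps:
  assumes "category (structured_sets Obs mor)" "category (structured_sets Obs' mor')"
    and obj: "\<And>A. A \<in> Obs \<Longrightarrow> F A \<in> Obs'"
    and carrier: "\<And>A. A \<in> Obs \<Longrightarrow> fst (F A) = fst A"
    and mor: "\<And>A B f. \<lbrakk>A \<in> Obs; B \<in> Obs; mor A B f\<rbrakk> \<Longrightarrow> mor' (F A) (F B) f"
  shows "category_functor (structured_sets Obs mor) (structured_sets Obs' mor')
    (identity_on_maps F)"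
proof -
  interpret source: category "structured_sets Obs mor" by fact
  interpret target: category "structured_sets Obs' mor'" by fact
  show ?thesis
    by unfold_locales
      (auto simp: structured_sets_def identity_on_maps_def obj mor carrier[simplified])
qed

lemma eq_functor_on_identity_on_maps_inverse:
  assumes "\<And>A. A \<in> Obs \<Longrightarrow> G (F A) = A"
  shows "eq_functor_on (structured_sets Obs mor)
    (comp_functor (identity_on_maps G) (identity_on_maps F)) id_functor"
  using assms
  by (auto simp: eq_functor_on_def structured_sets_def comp_functor_def identity_on_maps_def
      id_functor_def)

section \<open>Reachable and complete subsets\<close>

lemma is_DSC_depset:
  assumes "is_DSC E dep" "e \<in> E" "D \<in> dep e"
  shows "e \<notin> D" "complete_subset E dep D"
  using assms by (auto simp: is_DSC_def acyclic_dep_def complete_depsets_def)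

lemma reachable_imp_complete: "reachable E dep X \<Longrightarrow> complete_subset E dep X"
  unfolding reachable_def rch_def complete_subset_def by (meson order_trans)

lemma complete_subsetE:
  assumes "complete_subset E dep X" "e \<in> X"
  obtains D where "D \<in> dep e" "D \<subseteq> X"
  using assms by (auto simp: complete_subset_def)

lemma reachable_empty: "reachable E dep {}"
  by (auto simp: reachable_def rch_def)

text \<open>Composing one more step extends the witnessing sequence by the previous endpoint.\<close>

lemma reachable_rch:
  assumes "reachable E dep X" "rch E dep X Y"
  shows "reachable E dep Y"
proof -
  obtain n :: nat and Xs where Xs: "rch E dep {} (Xs 0)"
    "\<forall>i<n. rch E dep (Xs i) (Xs (Suc i))" "rch E dep (Xs n) X"
    using assms(1) unfolding reachable_def by blast
  let ?Ys = "Xs(Suc n := X)"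
  have "rch E dep {} (?Ys 0)" "\<forall>i<Suc n. rch E dep (?Ys i) (?Ys (Suc i))"
    "rch E dep (?Ys (Suc n)) Y"
    using Xs assms(2) by (auto simp: less_Suc_eq)
  then show ?thesis unfolding reachable_def by blast
qed

lemma complete_subset_Un:
  "complete_subset E dep X \<Longrightarrow> complete_subset E dep Y \<Longrightarrow> complete_subset E dep (X \<union> Y)"
  unfolding complete_subset_def by (meson Un_iff Un_least le_supI1 le_supI2)

lemma complete_subset_insert:
  assumes "complete_subset E dep X" "e \<in> E" "D \<in> dep e" "D \<subseteq> X"
  shows "complete_subset E dep (insert e X)"
proof -
  have X: "X \<subseteq> E" "\<forall>y\<in>X. \<exists>D\<in>dep y. D \<subseteq> X"
    using assms(1) by (simp_all add: complete_subset_def)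
  have "\<exists>D\<in>dep y. D \<subseteq> insert e X" if "y \<in> insert e X" for y
  proof (cases "y = e")
    case True
    then show ?thesis using assms(3,4) by (intro bexI[of _ D]) auto
  next
    case False
    then obtain D' where "D' \<in> dep y" "D' \<subseteq> X" using X(2) \<open>y \<in> insert e X\<close> by auto
    then show ?thesis by (intro bexI[of _ D']) auto
  qed
  then show ?thesis using X(1) assms(2) by (simp add: complete_subset_def)
qed

text \<open>A maximal complete proper subset \<open>Y\<close> of \<open>X\<close> misses exactly one element. If \<open>e\<close> lies in
  \<open>X - Y\<close> and \<open>D \<subseteq> X\<close> is a depset of \<open>e\<close>, then \<open>Y \<union> D\<close> is complete and, by acyclicity, still
  misses \<open>e\<close>; maximality gives \<open>D \<subseteq> Y\<close>. Thus \<open>insert e Y\<close> is complete, so it must be \<open>X\<close>.\<close>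

lemma complete_subset_remove_element:
  assumes dsc: "is_DSC E dep" and X: "complete_subset E dep X" "X \<noteq> {}"
  shows "\<exists>x\<in>X. complete_subset E dep (X - {x})"
proof -
  let ?S = "{Y. Y \<subset> X \<and> complete_subset E dep Y}"
  have XE: "X \<subseteq> E" using X(1) by (simp add: complete_subset_def)
  have "finite X" using dsc XE finite_subset by (auto simp: is_DSC_def preDSC_def)
  then have "finite ?S" by (auto intro: finite_subset[of _ "Pow X"])
  moreover have "{} \<in> ?S" using X by (auto simp: complete_subset_def)
  ultimately obtain Y where Y: "Y \<in> ?S" and max: "\<And>Z. Z \<in> ?S \<Longrightarrow> Y \<subseteq> Z \<Longrightarrow> Y = Z"
    using finite_has_maximal[of ?S] by (metis (no_types, lifting) empty_iff)
  obtain e where e: "e \<in> X" "e \<notin> Y" using Y by blast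
  obtain D where D: "D \<in> dep e" "D \<subseteq> X" using complete_subsetE[OF X(1) e(1)] .
  have eE: "e \<in> E" using e XE by blast
  have "Y \<union> D \<in> ?S"
    using Y D e is_DSC_depset[OF dsc eE D(1)] complete_subset_Un[of E dep Y D] by blast
  then have "D \<subseteq> Y" using max[of "Y \<union> D"] by blast
  then have "complete_subset E dep (insert e Y)"
    using complete_subset_insert[of E dep Y e D] Y D(1) eE by blast
  then have "insert e Y = X" using max[of "insert e Y"] Y e by blast
  then have "X - {e} = Y" using e by blast
  then show ?thesis using Y e by (intro bexI[of _ e]) simp_all
qed

text \<open>Removing elements one at a time gives a chain from \<open>X\<close> down to the empty set. Read upwards,
  each step \<open>X - {x}\<close> to \<open>X\<close> is an instance of \<open>rch\<close>: the old elements have depsets in \<open>X - {x}\<close>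
  by completeness of that set, and the depset of \<open>x\<close> in \<open>X\<close> avoids \<open>x\<close> by acyclicity.\<close>

lemma complete_imp_reachable:
  assumes dsc: "is_DSC E dep" and "complete_subset E dep X"
  shows "reachable E dep X"
proof -
  have "X \<subseteq> E" "finite E"
    using assms unfolding is_DSC_def preDSC_def complete_subset_def by blast+
  then have "finite X" by (rule finite_subset)
  then show ?thesis using assms(2)
  proof (induction X rule: finite_psubset_induct)
    case (psubset X)
    show ?case
    proof (cases "X = {}")
      case True
      then show ?thesis by (simp add: reachable_empty)
    next
      case False
      then obtain x where x: "x \<in> X" "complete_subset E dep (X - {x})"
        using complete_subset_remove_element[OF dsc psubset.prems] by blast
      have XE: "X \<subseteq> E" using psubset.prems by (simp add: complete_subset_def)
      have "\<exists>D\<in>dep y. D \<subseteq> X - {x}" if y: "y \<in> X" for y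
      proof (cases "y = x")
        case True
        obtain D where D: "D \<in> dep x" "D \<subseteq> X"
          using complete_subsetE[OF psubset.prems x(1)] .
        then have "x \<notin> D" using is_DSC_depset(1)[OF dsc] x(1) XE by blast
        then show ?thesis using D True by blast
      next
        case False
        then show ?thesis using complete_subsetE[OF x(2)] y by (metis Diff_iff singletonD)
      qed
      then have "rch E dep (X - {x}) X" using XE by (auto simp: rch_def)
      moreover have "reachable E dep (X - {x})" using psubset.IH x by blast
      ultimately show ?thesis by (rule reachable_rch[rotated])
    qed
  qed
qed

lemma rdp_eq_complete_subsets:
  "is_DSC E dep \<Longrightarrow> rdp E dep = {X. complete_subset E dep X}"
  using complete_imp_reachable[of E dep] reachable_imp_complete[of E dep]
  unfolding rdp_def complete_subset_def by blast

section \<open>The antimatroid of a DSC\<close>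

lemma antimatroid_rdp:
  assumes dsc: "is_DSC E dep"
  shows "antimatroid E (rdp E dep)"
proof -
  have fin: "finite E" and dep: "\<And>e. e \<in> E \<Longrightarrow> dep e \<noteq> {}"
    "\<And>e. e \<in> E \<Longrightarrow> dep e \<subseteq> Pow E"
    using dsc by (auto simp: is_DSC_def preDSC_def nonsingular_def)
  have "\<exists>D\<in>dep e. D \<subseteq> E" if "e \<in> E" for e using dep[OF that] by blast
  then have E: "complete_subset E dep E" by (simp add: complete_subset_def)
  have sub: "{X. complete_subset E dep X} \<subseteq> Pow E" by (auto simp: complete_subset_def)
  show ?thesis
    unfolding antimatroid_def rdp_eq_complete_subsets[OF dsc]
  proof (intro conjI)
    show "{X. complete_subset E dep X} \<noteq> {}" "E = \<Union>{X. complete_subset E dep X}"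
      using E sub by blast+
  qed (use fin sub complete_subset_Un[of E dep] complete_subset_remove_element[OF dsc] in simp_all)
qed

text \<open>A complete set containing \<open>e\<close> contains \<open>insert e D\<close> for some depset \<open>D\<close> of \<open>e\<close>, and this
  set is itself complete; irredundance forbids proper inclusions among the sets of this form.\<close>

lemma dep_of_rdp:
  assumes dsc: "is_DSC E dep"
  shows "dep_of E (rdp E dep) = dep"
proof
  fix e
  show "dep_of E (rdp E dep) e = dep e"
  proof (cases "e \<in> E")
    case False
    then show ?thesis using dsc by (auto simp: dep_of_def is_DSC_def preDSC_def)
  next
    case eE: True
    have irr: "\<And>D D'. D \<in> dep e \<Longrightarrow> D' \<in> dep e \<Longrightarrow> D \<subseteq> D' \<Longrightarrow> D = D'"
      using dsc eE by (auto simp: is_DSC_def irredundant_def)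
    have ins: "complete_subset E dep (insert e D)" if "D \<in> dep e" for D
      using complete_subset_insert[OF is_DSC_depset(2)[OF dsc eE that] eE that] by simp
    have minimal_iff: "minimal_feasible (rdp E dep) e M \<longleftrightarrow> (\<exists>D\<in>dep e. M = insert e D)" for M
    proof
      assume "minimal_feasible (rdp E dep) e M"
      then have M: "complete_subset E dep M" "e \<in> M"
        and min: "\<And>Y. complete_subset E dep Y \<Longrightarrow> Y \<subseteq> M \<Longrightarrow> e \<in> Y \<Longrightarrow> Y = M"
        by (simp_all add: minimal_feasible_def rdp_eq_complete_subsets[OF dsc])
      obtain D where D: "D \<in> dep e" "D \<subseteq> M"
        using complete_subsetE[OF M] .
      have "insert e D = M" using min[OF ins[OF D(1)]] D(2) M(2) by simp
      then show "\<exists>D\<in>dep e. M = insert e D" using D(1) by blast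
    next
      assume "\<exists>D\<in>dep e. M = insert e D"
      then obtain D where D: "D \<in> dep e" "M = insert e D" by blast
      have "Y = M" if Y: "complete_subset E dep Y" "Y \<subseteq> M" "e \<in> Y" for Y
      proof -
        obtain D' where D': "D' \<in> dep e" "D' \<subseteq> Y" using complete_subsetE[OF Y(1,3)] .
        have "D' \<subseteq> D" using D' Y D(2) is_DSC_depset(1)[OF dsc eE D'(1)] by blast
        then show ?thesis using irr[OF D'(1) D(1)] D' D(2) Y by blast
      qed
      then show "minimal_feasible (rdp E dep) e M"
        using ins[OF D(1)] D(2)
        by (simp add: minimal_feasible_def rdp_eq_complete_subsets[OF dsc])
    qed
    have "insert e D - {e} = D" if "D \<in> dep e" for D
      using is_DSC_depset(1)[OF dsc eE that] by blast
    then show ?thesis using eE by (auto simp: dep_of_def minimal_iff)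
  qed
qed

section \<open>The DSC of an antimatroid\<close>

lemma antimatroid_accessible:
  "antimatroid E \<F> \<Longrightarrow> S \<in> \<F> \<Longrightarrow> S \<noteq> {} \<Longrightarrow> \<exists>x\<in>S. S - {x} \<in> \<F>"
  by (simp add: antimatroid_def)

lemma antimatroid_minimal_feasible_below:
  assumes "antimatroid E \<F>" "X \<in> \<F>" "e \<in> X"
  obtains M where "minimal_feasible \<F> e M" "M \<subseteq> X"
proof -
  let ?S = "{Y \<in> \<F>. e \<in> Y}"
  have "finite ?S"
    using assms(1) by (auto simp: antimatroid_def intro: finite_subset[of _ "Pow E"])
  then obtain M where "M \<in> ?S" "M \<subseteq> X" "\<forall>Y\<in>?S. Y \<subseteq> M \<longrightarrow> M = Y"
    using finite_has_minimal2[of ?S X] assms by blast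
  then show thesis by (intro that[of M]) (auto simp: minimal_feasible_def)
qed

text \<open>Accessibility removes some element of a nonempty feasible set; for an \<open>e\<close>-minimal one,
  removing anything but \<open>e\<close> would contradict minimality.\<close>

lemma minimal_feasible_remove:
  assumes "antimatroid E \<F>" "minimal_feasible \<F> e M"
  shows "M - {e} \<in> \<F>"
proof -
  have M: "M \<in> \<F>" "e \<in> M" using assms(2) by (auto simp: minimal_feasible_def)
  then obtain x where x: "x \<in> M" "M - {x} \<in> \<F>"
    using antimatroid_accessible[OF assms(1)] by blast
  have "x = e"
  proof (rule ccontr)
    assume "x \<noteq> e"
    then have "M - {x} = M" using x(2) M(2) assms(2) by (simp add: minimal_feasible_def)
    then show False using x(1) by blast
  qed
  then show ?thesis using x by blast
qed

text \<open>A feasible set that is minimal under inclusion must be empty, by accessibility.\<close>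

lemma antimatroid_empty:
  assumes "antimatroid E \<F>"
  shows "{} \<in> \<F>"
proof -
  have fin: "finite \<F>"
    using assms by (auto simp: antimatroid_def intro: finite_subset[of _ "Pow E"])
  have "\<F> \<noteq> {}" using assms by (simp add: antimatroid_def)
  then obtain X where X: "X \<in> \<F>" and min: "\<forall>Y\<in>\<F>. Y \<subseteq> X \<longrightarrow> X = Y"
    using finite_has_minimal[OF fin] by auto
  show ?thesis
  proof (cases "X = {}")
    case False
    then obtain x where "x \<in> X" "X - {x} \<in> \<F>" using antimatroid_accessible[OF assms X] by blast
    moreover from this have "X = X - {x}" using min by simp
    ultimately show ?thesis by blast
  qed (use X in simp)
qed

lemma antimatroid_Union:
  assumes "antimatroid E \<F>" "finite \<A>" "\<A> \<subseteq> \<F>"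
  shows "\<Union>\<A> \<in> \<F>"
  using assms(2,3)
proof (induction \<A> rule: finite_induct)
  case empty
  then show ?case using antimatroid_empty[OF assms(1)] by simp
next
  case (insert A \<A>)
  then show ?case using assms(1) by (simp add: antimatroid_def)
qed

text \<open>A feasible set contains a minimal feasible set around each of its elements. Conversely,
  each element \<open>e\<close> of a complete set \<open>X\<close> has a depset \<open>D \<subseteq> X\<close>, and \<open>insert e D\<close> is a feasible
  subset of \<open>X\<close> around \<open>e\<close>; so \<open>X\<close> is the union of its feasible subsets.\<close>

lemma complete_subset_dep_of_iff:
  assumes am: "antimatroid E \<F>"
  shows "complete_subset E (dep_of E \<F>) X \<longleftrightarrow> X \<in> \<F>"
proof
  assume X: "X \<in> \<F>"
  then have XE: "X \<subseteq> E" using am by (auto simp: antimatroid_def)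
  have "\<exists>D\<in>dep_of E \<F> e. D \<subseteq> X" if e: "e \<in> X" for e
  proof -
    obtain M where "minimal_feasible \<F> e M" "M \<subseteq> X"
      using antimatroid_minimal_feasible_below[OF am X e] .
    then show ?thesis using e XE by (auto simp: dep_of_def)
  qed
  then show "complete_subset E (dep_of E \<F>) X" using XE by (simp add: complete_subset_def)
next
  assume X: "complete_subset E (dep_of E \<F>) X"
  let ?A = "{M \<in> \<F>. M \<subseteq> X}"
  have "e \<in> \<Union>?A" if e: "e \<in> X" for e
  proof -
    obtain D where "D \<in> dep_of E \<F> e" "D \<subseteq> X" and "e \<in> E"
      using X e complete_subsetE[OF X e] by (auto simp: complete_subset_def)
    then obtain M where "minimal_feasible \<F> e M" "M - {e} \<subseteq> X" by (auto simp: dep_of_def)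
    then show ?thesis using e unfolding minimal_feasible_def by blast
  qed
  then have "\<Union>?A = X" by blast
  moreover have "finite ?A"
    using am by (auto simp: antimatroid_def intro: finite_subset[of _ "Pow E"])
  ultimately show "X \<in> \<F>" using antimatroid_Union[OF am, of ?A] by auto
qed

lemma is_DSC_dep_of:
  assumes am: "antimatroid E \<F>"
  shows "is_DSC E (dep_of E \<F>)"
proof -
  have E: "finite E" "\<F> \<subseteq> Pow E" "E = \<Union>\<F>" using am by (auto simp: antimatroid_def)
  have "preDSC E (dep_of E \<F>)"
    using E(1,2) by (fastforce simp: preDSC_def dep_of_def minimal_feasible_def)
  moreover have "irredundant E (dep_of E \<F>)"
  proof -
    have "M = N"
      if "minimal_feasible \<F> e M" "minimal_feasible \<F> e N" "M - {e} \<subseteq> N - {e}" for e M N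
    proof -
      have "M \<subseteq> N" using that(2,3) by (auto simp: minimal_feasible_def)
      then show ?thesis using that(1,2) by (simp add: minimal_feasible_def)
    qed
    then show ?thesis by (force simp: irredundant_def dep_of_def)
  qed
  moreover have "acyclic_dep E (dep_of E \<F>)"
    by (auto simp: acyclic_dep_def dep_of_def)
  moreover have "nonsingular E (dep_of E \<F>)"
  proof -
    have "\<exists>M. minimal_feasible \<F> e M" if "e \<in> E" for e
      using that E(3) antimatroid_minimal_feasible_below[OF am] by blast
    then show ?thesis by (auto simp: nonsingular_def dep_of_def)
  qed
  moreover have "complete_depsets E (dep_of E \<F>)"
    unfolding complete_depsets_def complete_subset_dep_of_iff[OF am]
    by (auto simp: dep_of_def minimal_feasible_remove[OF am])
  ultimately show ?thesis by (simp add: is_DSC_def)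
qed

lemma rdp_dep_of:
  assumes "antimatroid E \<F>"
  shows "rdp E (dep_of E \<F>) = \<F>"
  using rdp_eq_complete_subsets[OF is_DSC_dep_of[OF assms]] complete_subset_dep_of_iff[OF assms]
  by simp

section \<open>The isomorphism of categories\<close>

lemma DSC_morphism_iff_antimatroid_morphism:
  "DSC_morphism (E, dep) (E', dep') f \<longleftrightarrow> antimatroid_morphism (E, rdp E dep) (E', rdp E' dep') f"
  by (auto simp: DSC_morphism_def antimatroid_morphism_def rdp_def)

lemma antimatroid_morphism_ident:
  assumes \<F>: "\<F> \<subseteq> Pow E"
  shows "antimatroid_morphism (E, \<F>) (E, \<F>) (\<lambda>x\<in>E. x)"
proof -
  have "(\<lambda>x\<in>E. x) -` A \<inter> E = A" if "A \<in> \<F>" for A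
  proof -
    have "A \<subseteq> E" using \<F> that by blast
    then show ?thesis by auto
  qed
  then show ?thesis by (auto simp: antimatroid_morphism_def)
qed

lemma antimatroid_morphism_compose:
  assumes f: "antimatroid_morphism (E, \<F>) (E', \<F>') f"
    and g: "antimatroid_morphism (E', \<F>') (E'', \<F>'') g"
  shows "antimatroid_morphism (E, \<F>) (E'', \<F>'') (compose E g f)"
proof -
  have fE: "f \<in> E \<rightarrow> E'" and gE: "g \<in> E' \<rightarrow> E''" using f g by (auto simp: antimatroid_morphism_def)
  have "compose E g f -` A \<inter> E = f -` (g -` A \<inter> E') \<inter> E" for A
    using fE by (auto simp: compose_def)
  moreover have "f -` (g -` A \<inter> E') \<inter> E \<in> \<F>" if "A \<in> \<F>''" for A
    using f g that by (simp add: antimatroid_morphism_def del: vimage_Int)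
  moreover have "compose E g f \<in> E \<rightarrow> E''" using fE gE by (auto simp: compose_def)
  ultimately show ?thesis by (simp add: antimatroid_morphism_def)
qed

lemma category_AntiMat: "category AntiMat"
  unfolding AntiMat_def
  by (rule category_structured_sets)
    (auto simp: antimatroid_def intro!: antimatroid_morphism_ident
      intro: antimatroid_morphism_compose)

lemma category_DSC: "category DSC"
  unfolding DSC_def
  by (rule category_structured_sets)
    (auto simp: DSC_morphism_iff_antimatroid_morphism rdp_def intro!: antimatroid_morphism_ident
      intro: antimatroid_morphism_compose)

lemma category_functor_Phi: "category_functor DSC AntiMat Phi"
  unfolding DSC_def AntiMat_def Phi_def
  by (rule category_functor_identity_on_maps)
    (auto simp: category_DSC[unfolded DSC_def] category_AntiMat[unfolded AntiMat_def]
      antimatroid_rdp DSC_morphism_iff_antimatroid_morphism)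

lemma category_functor_Psi: "category_functor AntiMat DSC Psi"
  unfolding DSC_def AntiMat_def Psi_def
  by (rule category_functor_identity_on_maps)
    (auto simp: category_DSC[unfolded DSC_def] category_AntiMat[unfolded AntiMat_def]
      is_DSC_dep_of DSC_morphism_iff_antimatroid_morphism rdp_dep_of)

lemma inverse_functors_Phi_Psi: "inverse_functors DSC AntiMat Phi Psi"
proof -
  have "eq_functor_on DSC (comp_functor Psi Phi) id_functor"
    unfolding DSC_def Phi_def Psi_def
    by (rule eq_functor_on_identity_on_maps_inverse) (auto simp: dep_of_rdp)
  moreover have "eq_functor_on AntiMat (comp_functor Phi Psi) id_functor"
    unfolding AntiMat_def Phi_def Psi_def
    by (rule eq_functor_on_identity_on_maps_inverse) (auto simp: rdp_dep_of)
  ultimately show ?thesis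
    by (simp add: inverse_functors_def category_functor_Phi category_functor_Psi)
qed

theorem theorem3p18:
  shows "category (DSC :: 'a DSC_category) \<and>
    category (AntiMat :: 'a AntiMat_category) \<and>
    category_functor (DSC :: 'a DSC_category) (AntiMat :: 'a AntiMat_category) Phi \<and>
    category_functor (AntiMat :: 'a AntiMat_category) (DSC :: 'a DSC_category) Psi \<and>
    inverse_functors (DSC :: 'a DSC_category) (AntiMat :: 'a AntiMat_category) Phi Psi \<and>
    isomorphic_categories (DSC :: 'a DSC_category) (AntiMat :: 'a AntiMat_category)"
  using category_DSC category_AntiMat category_functor_Phi category_functor_Psi
    inverse_functors_Phi_Psi
  unfolding isomorphic_categories_def by blast

end
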